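(* Let $G_\sigma=(V,E;\sigma)$ be a signed graph. The sign-connected components of $G_\sigma$ are exactly the unbalanced connected components of $G_\sigma$ together with the single vertices (as one-vertex subgraphs) of the balanced connected components of $G_\sigma$. In particular, $G_\sigma$ is sign connected if and only if either $G_\sigma$ is connected and unbalanced, or $|V|=1$.
   Context: A signed graph $G_\sigma=(V,E;\sigma)$ consists of a finite undirected graph $G=(V,E)$, in which loops and multiple edges are allowed, together with a map $\sigma:E\to\{-1,+1\}$. All cycles are elementary; a loop is a cycle of length 1. A chain is a walk $x,e_1,x_1,e_2,\dots,y$, not necessarily elementary. The sign of a cycle or of a chain is the product of the signs of its edges, each counted with multiplicity; it is called positive or negative accordingly. $G_\sigma$ is balanced if every cycle is positive. Two vertices $x,y$ are sign connected if $x=y$, or if there exist both a positive chain and a negative chain joining $x$ and $y$. This is an equivalence relation on $V$. The subgraphs of $G_\sigma$ induced by its equivalence classes are the sign-connected components of $G_\sigma$. $G_\sigma$ is sign connected if it has exactly one sign-connected component. *)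

theory Defs
  imports Main
begin

text \<open>
  Loops and multiple edges are allowed: edges are objects of their own, and \<open>ends G e\<close> is the set
  of end vertices of \<open>e\<close>, a singleton precisely when \<open>e\<close> is a loop.
\<close>

record ('v, 'e) sgraph =
  verts :: "'v set"
  edges :: "'e set"
  ends  :: "'e \<Rightarrow> 'v set"
  sig   :: "'e \<Rightarrow> int"

locale signed_graph =
  fixes G :: "('v, 'e) sgraph"
  assumes finite_verts: "finite (verts G)"
    and finite_edges: "finite (edges G)"
    and ends_edge: "e \<in> edges G \<Longrightarrow> \<exists>x\<in>verts G. \<exists>y\<in>verts G. ends G e = {x, y}"
    and sig_edge: "e \<in> edges G \<Longrightarrow> sig G e = -1 \<or> sig G e = 1"

text \<open>
  The chain \<open>x, e1, x1, e2, x2, \<dots>, y\<close> is given by its initial vertex \<open>x\<close> and the list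
  \<open>[(e1, x1), (e2, x2), \<dots>]\<close> of its steps. Vertices and edges may repeat; the chain of length
  0 is allowed.
\<close>

fun chain :: "('v, 'e) sgraph \<Rightarrow> 'v \<Rightarrow> ('e \<times> 'v) list \<Rightarrow> 'v \<Rightarrow> bool" where
  "chain G x [] y \<longleftrightarrow> x \<in> verts G \<and> x = y"
| "chain G x ((e, u) # p) y \<longleftrightarrow>
     x \<in> verts G \<and> e \<in> edges G \<and> ends G e = {x, u} \<and> chain G u p y"

definition chain_sign :: "('v, 'e) sgraph \<Rightarrow> ('e \<times> 'v) list \<Rightarrow> int" where
  "chain_sign G p = (\<Prod>(e, u)\<leftarrow>p. sig G e)"

text \<open>
  Cycles are elementary. Distinctness of the edges only matters in length 2, where it excludes
  going back and forth along one edge while admitting two parallel edges.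
\<close>

definition cycle :: "('v, 'e) sgraph \<Rightarrow> 'v \<Rightarrow> ('e \<times> 'v) list \<Rightarrow> bool" where
  "cycle G x p \<longleftrightarrow>
     p \<noteq> [] \<and> chain G x p x \<and> distinct (map snd p) \<and> distinct (map fst p)"

definition balanced :: "('v, 'e) sgraph \<Rightarrow> bool" where
  "balanced G \<longleftrightarrow> (\<forall>x p. cycle G x p \<longrightarrow> chain_sign G p = 1)"

definition induced_subgraph :: "('v, 'e) sgraph \<Rightarrow> 'v set \<Rightarrow> ('v, 'e) sgraph" where
  "induced_subgraph G W = G\<lparr>verts := W, edges := {e \<in> edges G. ends G e \<subseteq> W}\<rparr>"

definition connected_rel :: "('v, 'e) sgraph \<Rightarrow> ('v \<times> 'v) set" where
  "connected_rel G = {(x, y). x \<in> verts G \<and> y \<in> verts G \<and> (\<exists>p. chain G x p y)}"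

definition connected_components :: "('v, 'e) sgraph \<Rightarrow> ('v, 'e) sgraph set" where
  "connected_components G = induced_subgraph G ` (verts G // connected_rel G)"

definition connected_graph :: "('v, 'e) sgraph \<Rightarrow> bool" where
  "connected_graph G \<longleftrightarrow>
     verts G \<noteq> {} \<and> (\<forall>x\<in>verts G. \<forall>y\<in>verts G. \<exists>p. chain G x p y)"

definition sign_connected_rel :: "('v, 'e) sgraph \<Rightarrow> ('v \<times> 'v) set" where
  "sign_connected_rel G = {(x, y). x \<in> verts G \<and> y \<in> verts G \<and>
     (x = y \<or> (\<exists>p. chain G x p y \<and> chain_sign G p = 1) \<and>
              (\<exists>q. chain G x q y \<and> chain_sign G q = -1))}"

definition sign_connected_components :: "('v, 'e) sgraph \<Rightarrow> ('v, 'e) sgraph set" where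
  "sign_connected_components G = induced_subgraph G ` (verts G // sign_connected_rel G)"

definition sign_connected_graph :: "('v, 'e) sgraph \<Rightarrow> bool" where
  "sign_connected_graph G \<longleftrightarrow> (\<exists>!H. H \<in> sign_connected_components G)"

lemma chain_start: "chain G x p y \<Longrightarrow> x \<in> verts G"
  by (cases p) auto

lemma chain_append: "chain G x p y \<Longrightarrow> chain G y q z \<Longrightarrow> chain G x (p @ q) z"
  by (induction p arbitrary: x) auto

lemma chain_sign_append: "chain_sign G (p @ q) = chain_sign G p * chain_sign G q"
  by (simp add: chain_sign_def)

lemma chain_rev:
  assumes "chain G x p y"
  shows "\<exists>q. chain G y q x \<and> chain_sign G q = chain_sign G p"
  using assms
proof (induction p arbitrary: x)
  case Nil
  then show ?case by (intro exI[of _ "[]"]) auto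
next
  case (Cons a p)
  obtain e u where a: "a = (e, u)" by (cases a)
  from Cons.prems have s: "x \<in> verts G" "e \<in> edges G" "ends G e = {x, u}" "chain G u p y"
    by (auto simp: a)
  obtain q where q: "chain G y q u" "chain_sign G q = chain_sign G p"
    using Cons.IH[OF s(4)] by blast
  have "chain G u [(e, x)] x"
    using s chain_start[OF s(4)] by (auto simp: insert_commute)
  from chain_append[OF q(1) this] show ?case
    by (intro exI[of _ "q @ [(e, x)]"]) (use q(2) a in \<open>simp add: chain_sign_def\<close>)
qed

lemma equiv_connected_rel: "equiv (verts G) (connected_rel G)"
proof (rule equivI)
  show "connected_rel G \<subseteq> verts G \<times> verts G"
    by (auto simp: connected_rel_def)
  show "refl_on (verts G) (connected_rel G)"
    by (auto simp: connected_rel_def refl_on_def intro: exI[of _ "[]"])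
  show "sym (connected_rel G)"
    unfolding sym_def connected_rel_def using chain_rev by fast
  show "trans (connected_rel G)"
    unfolding trans_def connected_rel_def using chain_append by fast
qed

lemma equiv_sign_connected_rel: "equiv (verts G) (sign_connected_rel G)"
proof (rule equivI)
  show "sign_connected_rel G \<subseteq> verts G \<times> verts G"
    by (auto simp: sign_connected_rel_def)
  show "refl_on (verts G) (sign_connected_rel G)"
    by (auto simp: sign_connected_rel_def refl_on_def)
  show "sym (sign_connected_rel G)"
    unfolding sym_def sign_connected_rel_def using chain_rev by (clarsimp, metis)
  show "trans (sign_connected_rel G)"
  proof (rule transI)
    fix x y z
    assume xy: "(x, y) \<in> sign_connected_rel G" and yz: "(y, z) \<in> sign_connected_rel G"
    show "(x, z) \<in> sign_connected_rel G"
    proof (cases "x = y \<or> y = z")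
      case True
      then show ?thesis using xy yz by auto
    next
      case False
      then obtain p q p' where
        "chain G x p y" "chain_sign G p = 1" "chain G x q y" "chain_sign G q = -1"
        "chain G y p' z" "chain_sign G p' = 1"
        using xy yz unfolding sign_connected_rel_def by auto
      then have "chain G x (p @ p') z" "chain_sign G (p @ p') = 1"
        "chain G x (q @ p') z" "chain_sign G (q @ p') = -1"
        by (auto simp: chain_append chain_sign_append)
      moreover have "x \<in> verts G" "z \<in> verts G"
        using xy yz by (auto simp: sign_connected_rel_def)
      ultimately show ?thesis unfolding sign_connected_rel_def by blast
    qed
  qed
qed

end

theory Submission
  imports Defs
begin

text \<open>
  In a balanced graph every closed chain is positive: a closed chain that is not a cycle
  repeats a vertex or an edge, and can then be cut into shorter closed chains without changing its
  sign. Hence any two chains with the same end vertices have the same sign, and distinct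
  vertices are not sign connected. In an unbalanced component, on the other hand, a detour from
  \<open>x\<close> to a negative cycle, once around it and then back to \<open>x\<close>
  flips the sign of any chain from \<open>x\<close> to \<open>y\<close>.
\<close>

section \<open>Chains: concatenation and signs\<close>

lemma chain_append_iff:
  "chain G x (p @ q) z \<longleftrightarrow> (\<exists>y. chain G x p y \<and> chain G y q z)"
  by (induction p arbitrary: x) (auto dest: chain_start)

lemma chain_end: "chain G x p y \<Longrightarrow> y \<in> verts G"
  by (induction p arbitrary: x) auto

lemma chain_sign_Nil [simp]: "chain_sign G [] = 1"
  by (simp add: chain_sign_def)

lemma chain_sign_Cons [simp]: "chain_sign G ((e, u) # p) = sig G e * chain_sign G p"
  by (simp add: chain_sign_def)

lemma (in signed_graph) chain_sign_cases:
  "chain G x p y \<Longrightarrow> chain_sign G p = -1 \<or> chain_sign G p = 1"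
proof (induction p arbitrary: x)
  case (Cons a p)
  then show ?case using sig_edge by (cases a) fastforce
qed simp

section \<open>Closed chains in balanced graphs\<close>

lemma not_distinct_map_decomp:
  assumes "\<not> distinct (map f xs)"
  obtains ys a zs b us where "xs = ys @ a # zs @ b # us" "f a = f b"
proof -
  obtain ps qs rs y where "map f xs = ps @ [y] @ qs @ [y] @ rs"
    using not_distinct_decomp[OF assms] by blast
  then show thesis
    by (force simp: map_eq_append_conv append_eq_map_conv Cons_eq_map_conv intro: that)
qed

lemma (in signed_graph) closed_chain_positive:
  assumes "balanced G" and "chain G x p x"
  shows "chain_sign G p = 1"
  using assms(2)
proof (induction p arbitrary: x rule: length_induct)
  case (1 p)
  \<comment> \<open>The base vertex \<open>y\<close> is arbitrary because the pieces cut out of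
    \<open>p\<close> need not pass through \<open>x\<close>.\<close>
  have IH: "chain_sign G q = 1" if "length q < length p" "chain G y q y" for q y
    using 1 that by blast
  consider (Nil) "p = []" | (vertex) "\<not> distinct (map snd p)"
    | (edge) "distinct (map snd p)" "\<not> distinct (map fst p)" | (cycle) "cycle G x p"
    using 1(2) by (auto simp: cycle_def)
  then show ?case
  proof cases
    case Nil
    then show ?thesis by simp
  next
    case cycle
    then show ?thesis using assms(1) by (auto simp: balanced_def)
  next
    case vertex
    then obtain p1 a p2 b p3 where p: "p = p1 @ a # p2 @ b # p3" "snd a = snd b"
      by (rule not_distinct_map_decomp)
    obtain e f u where ab: "a = (e, u)" "b = (f, u)"
      using p(2) by (cases a, cases b) auto
    \<comment> \<open>Cut at the two visits to \<open>u\<close>: the part between them is closed at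
      \<open>u\<close>, and skipping it leaves a closed chain at \<open>x\<close>. Each piece omits
      \<open>a\<close> or \<open>b\<close>, so both are shorter than \<open>p\<close>.\<close>
    have "chain G x (p1 @ (e, u) # p3) x" "chain G u (p2 @ [(f, u)]) u"
      using 1(2) by (auto simp: p(1) ab chain_append_iff dest: chain_start)
    then have "chain_sign G (p1 @ (e, u) # p3) = 1" "chain_sign G (p2 @ [(f, u)]) = 1"
      by (intro IH; simp add: p(1))+
    moreover have "chain_sign G p
        = chain_sign G (p1 @ (e, u) # p3) * chain_sign G (p2 @ [(f, u)])"
      by (simp add: p(1) ab chain_sign_append)
    ultimately show ?thesis by simp
  next
    case edge
    obtain p1 a p2 b p3 where p: "p = p1 @ a # p2 @ b # p3" "fst a = fst b"
      using edge(2) by (rule not_distinct_map_decomp)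
    obtain e u v where ab: "a = (e, u)" "b = (e, v)"
      using p(2) by (cases a, cases b) auto
    obtain s t where c: "chain G x p1 s" "e \<in> edges G" "ends G e = {s, u}" "chain G u p2 t"
      "ends G e = {t, v}" "chain G v p3 x"
      using 1(2) by (auto simp: p(1) ab chain_append_iff)
    \<comment> \<open>Equal end vertices would be a repeated vertex, which this case
      excludes.\<close>
    have "u \<noteq> v"
      using edge(1) by (auto simp: p(1) ab)
    \<comment> \<open>so \<open>e\<close> is traversed once in each direction\<close>
    then have "s = v" "t = u"
      using c(3,5) by (auto simp: doubleton_eq_iff)
    \<comment> \<open>Deleting both traversals of \<open>e\<close> leaves two closed chains, and the
      deleted factor is a square, hence 1.\<close>
    then have "chain G x (p1 @ p3) x" "chain G u p2 u"
      using c by (auto intro: chain_append)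
    then have "chain_sign G (p1 @ p3) = 1" "chain_sign G p2 = 1"
      by (intro IH; simp add: p(1))+
    moreover have "chain_sign G p
        = (sig G e * sig G e) * chain_sign G (p1 @ p3) * chain_sign G p2"
      by (simp add: p(1) ab chain_sign_append)
    ultimately show ?thesis using sig_edge[OF c(2)] by auto
  qed
qed

text \<open>Following \<open>p\<close> and returning along the reverse of \<open>q\<close> is a
  closed chain, hence positive; two signs with product 1 agree.\<close>

lemma (in signed_graph) balanced_chain_sign_unique:
  assumes "balanced G" "chain G x p y" "chain G x q y"
  shows "chain_sign G p = chain_sign G q"
proof -
  obtain r where r: "chain G y r x" "chain_sign G r = chain_sign G q"
    using chain_rev[OF assms(3)] by blast
  have "chain_sign G p * chain_sign G q = 1"
    using closed_chain_positive[OF assms(1) chain_append[OF assms(2) r(1)]]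
    by (simp add: chain_sign_append r(2))
  then show ?thesis
    using chain_sign_cases[OF assms(2)] chain_sign_cases[OF assms(3)] by auto
qed

section \<open>Induced subgraphs and connected components\<close>

lemma verts_induced_subgraph [simp]: "verts (induced_subgraph G W) = W"
  by (simp add: induced_subgraph_def)

lemma chain_sign_induced_subgraph [simp]:
  "chain_sign (induced_subgraph G W) p = chain_sign G p"
  by (simp add: chain_sign_def induced_subgraph_def)

text \<open>Identifies the single component of a connected graph with the graph itself, so that
  statements about components carry over to \<open>G\<close>.\<close>

lemma (in signed_graph) induced_subgraph_verts: "induced_subgraph G (verts G) = G"
proof -
  have "{e \<in> edges G. ends G e \<subseteq> verts G} = edges G"
    using ends_edge by fastforce
  then show ?thesis by (simp add: induced_subgraph_def)
qed

text \<open>Allows the results on balanced graphs to be applied to one component at a time.\<close>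

lemma (in signed_graph) signed_graph_induced_subgraph:
  assumes "W \<subseteq> verts G"
  shows "signed_graph (induced_subgraph G W)"
proof
  show "finite (verts (induced_subgraph G W))"
    using assms finite_verts finite_subset by auto
  show "finite (edges (induced_subgraph G W))"
    using finite_edges by (simp add: induced_subgraph_def)
next
  fix e assume "e \<in> edges (induced_subgraph G W)"
  then have e: "e \<in> edges G" "ends G e \<subseteq> W"
    by (auto simp: induced_subgraph_def)
  show "\<exists>x\<in>verts (induced_subgraph G W). \<exists>y\<in>verts (induced_subgraph G W).
      ends (induced_subgraph G W) e = {x, y}"
    using ends_edge[OF e(1)] e(2) by (auto simp: induced_subgraph_def)
  show "sig (induced_subgraph G W) e = -1 \<or> sig (induced_subgraph G W) e = 1"
    using sig_edge[OF e(1)] by (simp add: induced_subgraph_def)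
qed

lemma chain_induced_subgraphD:
  "chain (induced_subgraph G W) x p y \<Longrightarrow> W \<subseteq> verts G \<Longrightarrow> chain G x p y"
  by (induction p arbitrary: x) (auto simp: induced_subgraph_def)

lemma connected_rel_iff: "(x, y) \<in> connected_rel G \<longleftrightarrow> (\<exists>p. chain G x p y)"
  by (auto simp: connected_rel_def dest: chain_start chain_end)

lemma connected_class_subset: "connected_rel G `` {x} \<subseteq> verts G"
  by (auto simp: connected_rel_def)

text \<open>A chain never leaves the component in which it starts, since each of its vertices is
  reached by an initial piece. Balance of a component thereby controls chains of
  \<open>G\<close>.\<close>

lemma chain_in_component:
  assumes "chain G x p y" "(z, x) \<in> connected_rel G"
  shows "chain (induced_subgraph G (connected_rel G `` {z})) x p y"
  using assms
proof (induction p arbitrary: x)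
  case (Cons a p)
  obtain e u where a: "a = (e, u)" by (cases a)
  have e: "e \<in> edges G" "ends G e = {x, u}" "chain G u p y"
    using Cons.prems(1) by (auto simp: a)
  have "chain G x [(e, u)] u"
    using Cons.prems(1) chain_start by (auto simp: a)
  then have u: "(z, u) \<in> connected_rel G"
    using Cons.prems(2) unfolding connected_rel_iff by (meson chain_append)
  show ?case
    using Cons.IH[OF e(3) u] Cons.prems(2) e u by (simp add: a induced_subgraph_def)
qed simp

section \<open>The sign-connected class of a vertex\<close>

lemma sign_connected_rel_subset: "sign_connected_rel G \<subseteq> connected_rel G"
  unfolding sign_connected_rel_def connected_rel_def by (auto intro: exI[of _ "[]"])

lemma (in signed_graph) sign_class_of_balanced:
  assumes "balanced (induced_subgraph G (connected_rel G `` {x}))" "x \<in> verts G"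
  shows "sign_connected_rel G `` {x} = {x}"
proof -
  interpret H: signed_graph "induced_subgraph G (connected_rel G `` {x})"
    by (intro signed_graph_induced_subgraph connected_class_subset)
  have xx: "(x, x) \<in> connected_rel G"
    using equiv_class_self[OF equiv_connected_rel assms(2)] by simp
  \<comment> \<open>Only the component of \<open>x\<close> is known to be balanced, so both chains
    are first moved into it; this keeps their signs.\<close>
  have unique: "chain_sign G p = chain_sign G q" if "chain G x p y" "chain G x q y" for p q y
    using H.balanced_chain_sign_unique[OF assms(1) that[THEN chain_in_component[OF _ xx]]]
    by simp
  have "y = x" if xy: "(x, y) \<in> sign_connected_rel G" for y
  proof (rule ccontr)
    assume "y \<noteq> x"
    then obtain p q where "chain G x p y" "chain_sign G p = 1" "chain G x q y" "chain_sign G q = -1"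
      using xy by (auto simp: sign_connected_rel_def)
    then show False using unique[of p y q] by simp
  qed
  then show ?thesis
    using assms(2) by (auto simp: sign_connected_rel_def)
qed

lemma (in signed_graph) sign_class_of_unbalanced:
  assumes "\<not> balanced (induced_subgraph G (connected_rel G `` {x}))"
  shows "sign_connected_rel G `` {x} = connected_rel G `` {x}"
proof
  show "sign_connected_rel G `` {x} \<subseteq> connected_rel G `` {x}"
    using sign_connected_rel_subset by blast
next
  let ?H = "induced_subgraph G (connected_rel G `` {x})"
  obtain z c where c: "chain ?H z c z" "chain_sign G c \<noteq> 1"
    using assms by (auto simp: balanced_def cycle_def)
  have cG: "chain G z c z"
    using c(1) by (rule chain_induced_subgraphD) (rule connected_class_subset)
  have neg: "chain_sign G c = -1"
    using chain_sign_cases[OF cG] c(2) by simp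
  \<comment> \<open>\<open>z\<close> is a vertex of the component of \<open>x\<close>, so the
    negative cycle can be reached from \<open>x\<close>.\<close>
  obtain p where p: "chain G x p z"
    using chain_start[OF c(1)] by (auto simp: connected_rel_iff)
  show "connected_rel G `` {x} \<subseteq> sign_connected_rel G `` {x}"
  proof
    fix y assume "y \<in> connected_rel G `` {x}"
    then obtain q where q: "chain G x q y" by (auto simp: connected_rel_iff)
    obtain r where r: "chain G z r x" "chain_sign G r = chain_sign G p"
      using chain_rev[OF p] by blast
    have 1: "chain G x (p @ c @ r @ q) y"
      by (intro chain_append[OF p] chain_append[OF cG] chain_append[OF r(1)] q)
    \<comment> \<open>\<open>p\<close> and its reversal \<open>r\<close> contribute a square, so
      only the factor -1 of \<open>c\<close> remains.\<close>
    have 2: "chain_sign G (p @ c @ r @ q) = - chain_sign G q"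
      using chain_sign_cases[OF p] by (auto simp: chain_sign_append r(2) neg)
    have "chain_sign G q = -1 \<or> chain_sign G q = 1"
      by (rule chain_sign_cases[OF q])
    then have "(\<exists>p. chain G x p y \<and> chain_sign G p = 1) \<and> (\<exists>q. chain G x q y \<and> chain_sign G q = -1)"
    proof
      assume "chain_sign G q = -1"
      then show ?thesis using 1 2 q by (intro conjI exI[of _ "p @ c @ r @ q"] exI[of _ q]) simp_all
    next
      assume "chain_sign G q = 1"
      then show ?thesis using 1 2 q by (intro conjI exI[of _ "p @ c @ r @ q"] exI[of _ q]) simp_all
    qed
    then show "y \<in> sign_connected_rel G `` {x}"
      using chain_start[OF q] chain_end[OF q] by (auto simp: sign_connected_rel_def)
  qed
qed

section \<open>From classes to components\<close>

lemma connected_graph_iff: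
  "connected_graph G \<longleftrightarrow> verts G \<noteq> {} \<and> (\<forall>x\<in>verts G. connected_rel G `` {x} = verts G)"
  by (auto simp: connected_graph_def connected_rel_def)

text \<open>A class is recovered as the vertex set of the subgraph it induces, so a unique component
  amounts to a unique class.\<close>

lemma sign_connected_graph_iff:
  "sign_connected_graph G \<longleftrightarrow>
     verts G \<noteq> {} \<and> (\<forall>x\<in>verts G. sign_connected_rel G `` {x} = verts G)"
proof
  assume "sign_connected_graph G"
  then obtain H where H: "sign_connected_components G = {H}"
    unfolding sign_connected_graph_def by blast
  then have "verts G \<noteq> {}"
    by (auto simp: sign_connected_components_def)
  have "sign_connected_rel G `` {x} = verts H" if "x \<in> verts G" for x
  proof -
    have "induced_subgraph G (sign_connected_rel G `` {x}) \<in> sign_connected_components G"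
      using that by (auto simp: sign_connected_components_def quotientI)
    then show ?thesis unfolding H by auto
  qed
  \<comment> \<open>All classes equal \<open>verts H\<close>, and every vertex lies in its own
    class.\<close>
  then have "sign_connected_rel G `` {x} = verts G" if "x \<in> verts G" for x
    using that equiv_class_self[OF equiv_sign_connected_rel]
    by (auto simp: sign_connected_rel_def)
  then show "verts G \<noteq> {} \<and> (\<forall>x\<in>verts G. sign_connected_rel G `` {x} = verts G)"
    using \<open>verts G \<noteq> {}\<close> by blast
next
  assume "verts G \<noteq> {} \<and> (\<forall>x\<in>verts G. sign_connected_rel G `` {x} = verts G)"
  then have "verts G // sign_connected_rel G = {verts G}"
    by (auto simp: quotient_def)
  then show "sign_connected_graph G"
    by (simp add: sign_connected_graph_def sign_connected_components_def)
qed

lemma (in signed_graph) sign_connected_components_eq: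
  "sign_connected_components G =
     {H \<in> connected_components G. \<not> balanced H} \<union>
     {induced_subgraph G {x} | x H. H \<in> connected_components G \<and> balanced H \<and> x \<in> verts H}"
    (is "_ = ?U \<union> ?B")
proof -
  let ?C = "\<lambda>x. connected_rel G `` {x}" and ?S = "\<lambda>x. sign_connected_rel G `` {x}"
  \<comment> \<open>Indexing both families by the vertices of \<open>G\<close> reduces the claim to
    comparing \<open>?S x\<close> with \<open>?C x\<close> for one \<open>x\<close>.\<close>
  have cc: "connected_components G = (\<lambda>x. induced_subgraph G (?C x)) ` verts G"
    by (auto simp: connected_components_def quotient_def)
  have sc: "sign_connected_components G = (\<lambda>x. induced_subgraph G (?S x)) ` verts G"
    by (auto simp: sign_connected_components_def quotient_def)
  show ?thesis
  proof (intro equalityI subsetI)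
    fix H assume "H \<in> sign_connected_components G"
    then obtain x where x: "x \<in> verts G" "H = induced_subgraph G (?S x)"
      by (auto simp: sc)
    show "H \<in> ?U \<union> ?B"
    proof (cases "balanced (induced_subgraph G (?C x))")
      case True
      have "x \<in> ?C x"
        using x(1) by (rule equiv_class_self[OF equiv_connected_rel])
      then have "H \<in> ?B"
        using x True sign_class_of_balanced[OF True x(1)] by (auto simp: cc)
      then show ?thesis ..
    next
      case False
      then show ?thesis
        using x sign_class_of_unbalanced[OF False] by (auto simp: cc)
    qed
  next
    fix H assume "H \<in> ?U \<union> ?B"
    then show "H \<in> sign_connected_components G"
    proof
      assume "H \<in> ?U"
      then obtain x where x: "x \<in> verts G" "H = induced_subgraph G (?C x)"
        "\<not> balanced (induced_subgraph G (?C x))"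
        by (auto simp: cc)
      have "H = induced_subgraph G (?S x)"
        by (simp only: x(2) sign_class_of_unbalanced[OF x(3)])
      then show ?thesis
        using x(1) unfolding sc by (rule image_eqI)
    next
      assume "H \<in> ?B"
      then obtain x y where xy: "H = induced_subgraph G {x}" "balanced (induced_subgraph G (?C y))"
        "(y, x) \<in> connected_rel G"
        by (auto simp: cc)
      \<comment> \<open>The balanced component is given by a representative \<open>y\<close>; it is
        rewritten as the component of the chosen vertex \<open>x\<close>.\<close>
      have "?C y = ?C x"
        using xy(3) by (rule equiv_class_eq[OF equiv_connected_rel])
      moreover have x: "x \<in> verts G"
        using xy(3) by (simp add: connected_rel_def)
      ultimately have "?S x = {x}"
        using xy(2) sign_class_of_balanced[of x] by simp
      then have "H = induced_subgraph G (?S x)"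
        by (simp only: xy(1))
      from this x show ?thesis
        unfolding sc by (rule image_eqI)
    qed
  qed
qed

lemma (in signed_graph) sign_connected_graph_characterization:
  "sign_connected_graph G \<longleftrightarrow> (connected_graph G \<and> \<not> balanced G) \<or> card (verts G) = 1"
proof
  assume "sign_connected_graph G"
  then have ne: "verts G \<noteq> {}" and all: "\<And>x. x \<in> verts G \<Longrightarrow> sign_connected_rel G `` {x} = verts G"
    by (auto simp: sign_connected_graph_iff)
  \<comment> \<open>The connected class lies between the sign-connected class, which is everything,
    and \<open>verts G\<close>.\<close>
  have C: "connected_rel G `` {x} = verts G" if "x \<in> verts G" for x
    using all[OF that] sign_connected_rel_subset[of G] connected_class_subset[of G x] by blast
  obtain x where x: "x \<in> verts G" using ne by blast
  show "(connected_graph G \<and> \<not> balanced G) \<or> card (verts G) = 1"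
  proof (cases "balanced G")
    case True
    \<comment> \<open>By \<open>C\<close> the component of \<open>x\<close> is \<open>G\<close>
      itself, so its balance makes the sign-connected class of \<open>x\<close> a singleton.\<close>
    then have "verts G = {x}"
      using sign_class_of_balanced[of x] x all[OF x] by (simp add: C induced_subgraph_verts)
    then show ?thesis by simp
  next
    case False
    then show ?thesis using ne C by (simp add: connected_graph_iff)
  qed
next
  assume "(connected_graph G \<and> \<not> balanced G) \<or> card (verts G) = 1"
  then show "sign_connected_graph G"
  proof
    assume "connected_graph G \<and> \<not> balanced G"
    then show ?thesis
      using sign_class_of_unbalanced
      by (auto simp: connected_graph_iff sign_connected_graph_iff induced_subgraph_verts)
  next
    assume "card (verts G) = 1"
    then obtain x where "verts G = {x}" by (rule card_1_singletonE)
    then show ?thesis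
      by (auto simp: sign_connected_graph_iff sign_connected_rel_def)
  qed
qed

theorem theorem3p3:
  fixes G :: "('v, 'e) sgraph"
  assumes "signed_graph G"
  shows "sign_connected_components G =
           {H \<in> connected_components G. \<not> balanced H} \<union>
           {induced_subgraph G {x} | x H. H \<in> connected_components G \<and> balanced H \<and> x \<in> verts H}
         \<and> (sign_connected_graph G \<longleftrightarrow>
              (connected_graph G \<and> \<not> balanced G) \<or> card (verts G) = 1)"
  using signed_graph.sign_connected_components_eq[OF assms]
    signed_graph.sign_connected_graph_characterization[OF assms] by (rule conjI)

end
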